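(* Let $m\ge n\ge 1$ be integers, let $c,a\in\mathbb{R}^m$, let $w\in\mathbb{R}^n$ satisfy $w_1>w_2>\cdots>w_n>0$, and let $b_2\in\mathbb{R}$. Let $\lambda^*$ be an optimal solution of the dual problem $\min_{\lambda\ge 0} g(\lambda)$, where $$g(\lambda):=\max_{X\in\mathcal{S}_{m,n}}\ \bigl[c^\top X w-\lambda(a^\top X w-b_2)\bigr],$$ and let $\lambda_{\min},\lambda_{\max}\in\mathbb{R}$ satisfy $\lambda_{\min}\le\lambda^*\le\lambda_{\max}$. Let $i\in[m]$, and suppose there exist pairwise distinct indices $i_1,\dots,i_n\in[m]$ such that $$(c-\lambda_{\min}a)_i<\min_{k\in[n]}\{(c-\lambda_{\min}a)_{i_k}\}\quad\text{and}\quad (c-\lambda_{\max}a)_i<\min_{k\in[n]}\{(c-\lambda_{\max}a)_{i_k}\}.$$ Then for every optimal solution $X$ of the problem $$\max_{X\in\mathbb{R}^{m\times n}} c^\top X w\quad\text{s.t. } X\in\mathcal{S}_{m,n},\ a^\top X w\le b_2,$$ the $i$-th row of $X$ is zero.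
   Context: For integers $m,n$, $$\mathcal{S}_{m,n}:=\{X\in\mathbb{R}^{m\times n}\mid X1_n\le 1_m,\ 1_m^\top X=1_n^\top,\ X\ge 0\},$$ where $1_k\in\mathbb{R}^k$ is the vector with all coordinates equal to $1$ and inequalities between vectors or matrices are entrywise. $[k]:=\{1,\dots,k\}$, and $(y)_i$ denotes the $i$-th coordinate of a vector $y$. *)

theory Defs
  imports "HOL-Analysis.Analysis"
begin

text \<open>
  Here \<open>1\<close> is the all-ones vector, and \<open>\<le>\<close> on vectors and matrices is entrywise.
\<close>

definition assign_set :: "(real^'n^'m) set" where
  "assign_set = {X. X *v 1 \<le> 1 \<and> 1 v* X = 1 \<and> 0 \<le> X}"

text \<open>
  The supremum is a maximum whenever \<open>CARD('n) \<le> CARD('m)\<close>; see \<open>dual_fun_attained\<close>.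
\<close>

definition dual_fun :: "real^'m \<Rightarrow> real^'m \<Rightarrow> real^'n \<Rightarrow> real \<Rightarrow> real \<Rightarrow> real" where
  "dual_fun c a w b l =
     (SUP X\<in>assign_set. c \<bullet> (X *v w) - l * (a \<bullet> (X *v w) - b))"

lemma assign_set_iff:
  "X \<in> assign_set \<longleftrightarrow>
     (\<forall>i. (\<Sum>j\<in>UNIV. X$i$j) \<le> 1) \<and> (\<forall>j. (\<Sum>i\<in>UNIV. X$i$j) = 1) \<and> (\<forall>i j. 0 \<le> X$i$j)"
  by (simp add: assign_set_def less_eq_vec_def matrix_vector_mult_def vector_matrix_mult_def
      vec_eq_iff)

lemma assign_set_nonempty:
  assumes "CARD('n::finite) \<le> CARD('m::finite)"
  shows "assign_set \<noteq> ({} :: (real^'n^'m) set)"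
proof -
  obtain f :: "'n \<Rightarrow> 'm" where f: "inj f"
    using assms card_le_inj[of "UNIV :: 'n set" "UNIV :: 'm set"] by auto
  define X :: "real^'n^'m" where "X = (\<chi> i j. if f j = i then 1 else 0)"
  have "(\<Sum>j\<in>UNIV. X$i$j) \<le> 1" for i
  proof (cases "\<exists>k. f k = i")
    case True
    then obtain k where "f k = i" by blast
    then have "X$i$j = (if j = k then 1 else 0)" for j
      using f by (auto simp: X_def inj_eq)
    then show ?thesis by simp
  next
    case False
    then show ?thesis by (simp add: X_def)
  qed
  then have "X \<in> assign_set"
    by (auto simp: assign_set_iff X_def)
  then show ?thesis by blast
qed

lemma compact_assign_set: "compact (assign_set :: (real^'n::finite^'m::finite) set)"
proof -
  have "norm X \<le> real CARD('m) * real CARD('n)" if "X \<in> assign_set" for X :: "real^'n^'m"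
  proof -
    have "X$i$j \<le> 1" "0 \<le> X$i$j" for i j
    proof -
      have nn: "\<And>i j. 0 \<le> X$i$j" and le: "(\<Sum>j\<in>UNIV. X$i$j) \<le> 1"
        using that by (auto simp: assign_set_iff)
      show "0 \<le> X$i$j" by (rule nn)
      have "X$i$j \<le> (\<Sum>j\<in>UNIV. X$i$j)"
        by (rule member_le_sum) (auto simp: nn)
      with le show "X$i$j \<le> 1" by simp
    qed
    then have "\<And>i j. \<bar>X$i$j\<bar> \<le> 1" by simp
    then have "norm (X$i) \<le> real CARD('n)" for i
      using norm_le_l1_cart[of "X$i"] sum_bounded_above[of "UNIV :: 'n set" "\<lambda>j. \<bar>X$i$j\<bar>" 1]
      by simp
    then have "(\<Sum>i\<in>UNIV. norm (X$i)) \<le> real CARD('m) * real CARD('n)"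
      using sum_bounded_above[of "UNIV :: 'm set" "\<lambda>i. norm (X$i)" "real CARD('n)"] by simp
    moreover have "norm X \<le> (\<Sum>i\<in>UNIV. norm (X$i))"
      by (simp add: norm_vec_def L2_set_le_sum)
    ultimately show ?thesis by simp
  qed
  then have "bounded (assign_set :: (real^'n^'m) set)"
    by (auto simp: bounded_iff)
  moreover have "closed (assign_set :: (real^'n^'m) set)"
  proof -
    have *: "assign_set = {X :: real^'n^'m. (\<forall>i. (\<Sum>j\<in>UNIV. X$i$j) \<le> 1) \<and>
        (\<forall>j. (\<Sum>i\<in>UNIV. X$i$j) = 1) \<and> (\<forall>i j. 0 \<le> X$i$j)}"
      by (auto simp: assign_set_iff)
    show ?thesis
      unfolding *
      by (intro closed_Collect_conj closed_Collect_all closed_Collect_le closed_Collect_eq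
          continuous_intros)
  qed
  ultimately show ?thesis by (simp add: compact_eq_bounded_closed)
qed

lemma dual_fun_attained:
  fixes c a :: "real^'m::finite" and w :: "real^'n::finite"
  assumes "CARD('n) \<le> CARD('m)"
  obtains X where "X \<in> assign_set"
    and "dual_fun c a w b l = c \<bullet> (X *v w) - l * (a \<bullet> (X *v w) - b)"
    and "\<And>Y. Y \<in> assign_set \<Longrightarrow> c \<bullet> (Y *v w) - l * (a \<bullet> (Y *v w) - b) \<le> dual_fun c a w b l"
proof -
  let ?L = "\<lambda>X :: real^'n^'m. c \<bullet> (X *v w) - l * (a \<bullet> (X *v w) - b)"
  have "continuous_on assign_set ?L"
    unfolding matrix_vector_mult_def
    by (intro continuous_intros)
  then obtain X where X: "X \<in> assign_set" "\<And>Y. Y \<in> assign_set \<Longrightarrow> ?L Y \<le> ?L X"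
    using continuous_attains_sup[OF compact_assign_set assign_set_nonempty[OF assms]] by blast
  then have "dual_fun c a w b l = ?L X"
    unfolding dual_fun_def by (intro cSup_eq_maximum) auto
  with X show ?thesis by (intro that[of X]) auto
qed

end

theory Submission imports Defs begin

text \<open>
  The pairs \<open>(a \<bullet> Xw - b, c \<bullet> Xw)\<close> with \<open>X\<close> in the assignment polytope form a compact convex
  set in the plane. If the dual optimum exceeded the primal one, separating this set from the
  quadrant of nonpositive first and too large second coordinates would give a multiplier with a
  smaller dual value; no Slater condition is needed because the dual optimum is attained by
  hypothesis. Hence a primal optimal \<open>X\<close> maximizes the Lagrangian at the optimal multiplier, whose
  score vector \<open>c - \<lambda>a\<close> is a convex combination of the two end point score vectors. If row \<open>i\<close> of
  \<open>X\<close> were nonzero, one of the \<open>n\<close> rows with higher score would have spare capacity, and moving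
  mass there from row \<open>i\<close> would increase the Lagrangian.
\<close>

text \<open>A line strictly separating \<open>P\<close> from the quadrant \<open>u \<le> 0\<close>,
  \<open>v \<ge> t\<close> has a normal with \<open>\<beta> > 0\<close> and
  \<open>\<alpha> \<le> 0\<close>; dividing by \<open>\<beta>\<close> turns it into the
  multiplier.\<close>

lemma multiplier_below_exists:
  fixes P :: "(real \<times> real) set"
  assumes "compact P" "convex P" "(u0, v0) \<in> P" "u0 \<le> 0"
    and below: "\<And>u v. (u, v) \<in> P \<Longrightarrow> u \<le> 0 \<Longrightarrow> v < t"
  shows "\<exists>l\<ge>0. \<forall>(u, v)\<in>P. v - l * u < t"
proof -
  let ?Q = "{..0::real} \<times> {t..}"
  have "P \<inter> ?Q = {}"
    using below by fastforce
  moreover have "convex ?Q" "closed ?Q"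
    by (auto intro: convex_Times closed_Times)
  ultimately obtain q \<gamma> where P: "\<forall>x\<in>P. q \<bullet> x < \<gamma>" and Q: "\<forall>x\<in>?Q. q \<bullet> x > \<gamma>"
    using separating_hyperplane_compact_closed[of P ?Q] assms by blast
  obtain \<alpha> \<beta> where q: "q = (\<alpha>, \<beta>)" by (cases q)
  have P': "\<alpha> * u + \<beta> * v < \<gamma>" if "(u, v) \<in> P" for u v
    using bspec[OF P that] by (simp add: q)
  have Q': "\<gamma> < \<alpha> * s + \<beta> * r" if "s \<le> 0" "t \<le> r" for s r
    using bspec[OF Q, of "(s, r)"] that by (simp add: q)
  \<comment> \<open>Comparing with the quadrant point \<open>(u0, t)\<close> cancels the
    \<open>\<alpha>\<close> term, so the line cannot be vertical.\<close>
  have "\<beta> * (t - v0) > 0"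
    using P'[OF assms(3)] Q'[of u0 t] assms(4) by (simp add: algebra_simps)
  moreover have "t - v0 > 0"
    using below assms(3,4) by fastforce
  ultimately have "\<beta> > 0"
    by (simp add: zero_less_mult_iff)
  have "\<alpha> \<le> 0"
  proof (rule ccontr)
    assume "\<not> \<alpha> \<le> 0"
    \<comment> \<open>With \<open>\<alpha> > 0\<close>, going this far left in the quadrant brings
      the functional down to \<open>\<gamma>\<close> or below; the absolute value keeps
      \<open>s\<close> nonpositive.\<close>
    moreover define s where "s = - \<bar>(\<gamma> - \<beta> * t) / \<alpha>\<bar>"
    ultimately have "\<alpha> * s \<le> \<gamma> - \<beta> * t"
      by (auto simp: abs_if field_simps)
    with Q'[of s t] show False by (simp add: s_def)
  qed
  show ?thesis
  proof (rule exI[of _ "- \<alpha> / \<beta>"], safe)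
    show "0 \<le> - \<alpha> / \<beta>" using \<open>\<alpha> \<le> 0\<close> \<open>\<beta> > 0\<close> by (simp add: divide_nonpos_pos)
  next
    fix u v
    assume "(u, v) \<in> P"
    then have "\<alpha> * u + \<beta> * v < \<beta> * t"
      using P'[of u v] Q'[of 0 t] by simp
    then show "v - - \<alpha> / \<beta> * u < t"
      using \<open>\<beta> > 0\<close> by (simp add: field_simps)
  qed
qed

lemma convex_assign_set: "convex (assign_set :: (real^'n::finite^'m::finite) set)"
  unfolding convex_def
  by (auto simp: assign_set_iff sum.distrib sum_distrib_left[symmetric]
      intro: convex_bound_le)

text \<open>Writing \<open>L\<close> for the Lagrangian at \<open>lopt\<close> and \<open>d\<close>
  for the dual optimum, \<open>L Y \<le> d \<le> c \<bullet> (X *v w) \<le> L X\<close>; the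
  constant \<open>lopt * b\<close> cancels. The middle inequality is strong duality.\<close>

lemma primal_optimal_maximizes_lagrangian:
  fixes c a :: "real^'m::finite" and w :: "real^'n::finite"
  assumes card: "CARD('n) \<le> CARD('m)"
    and dual: "is_arg_min (dual_fun c a w b) (\<lambda>l. 0 \<le> l) lopt"
    and primal: "is_arg_max (\<lambda>X. c \<bullet> (X *v w)) (\<lambda>X. X \<in> assign_set \<and> a \<bullet> (X *v w) \<le> b) X"
    and Y: "Y \<in> assign_set"
  shows "(c - lopt *\<^sub>R a) \<bullet> (Y *v w) \<le> (c - lopt *\<^sub>R a) \<bullet> (X *v w)"
proof -
  define \<phi> where "\<phi> Z = (a \<bullet> (Z *v w) - b, c \<bullet> (Z *v w))" for Z :: "real^'n^'m"
  let ?d = "dual_fun c a w b lopt"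
  have l0: "0 \<le> lopt" and min: "\<And>l. 0 \<le> l \<Longrightarrow> ?d \<le> dual_fun c a w b l"
    using dual by (auto simp: is_arg_min_linorder)
  have X: "X \<in> assign_set" "a \<bullet> (X *v w) \<le> b"
    and max: "\<And>Z. Z \<in> assign_set \<Longrightarrow> a \<bullet> (Z *v w) \<le> b \<Longrightarrow> c \<bullet> (Z *v w) \<le> c \<bullet> (X *v w)"
    using primal by (auto simp: is_arg_max_linorder)
  have "?d \<le> c \<bullet> (X *v w)"
  proof (rule ccontr)
    assume *: "\<not> ?d \<le> c \<bullet> (X *v w)"
    have "compact (\<phi> ` assign_set)"
      unfolding \<phi>_def matrix_vector_mult_def
      by (intro compact_continuous_image compact_assign_set continuous_intros)
    moreover have "convex (\<phi> ` assign_set)"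
    proof -
      have "linear (\<lambda>Z :: real^'n^'m. (a \<bullet> (Z *v w), c \<bullet> (Z *v w)))"
        by (rule linearI)
          (auto simp: matrix_vector_mult_add_rdistrib inner_add_right scaleR_matrix_vector_assoc[symmetric])
      then have "convex ((\<lambda>p. (- b, 0) + p) ` (\<lambda>Z. (a \<bullet> (Z *v w), c \<bullet> (Z *v w))) ` assign_set)"
        by (intro convex_translation convex_linear_image convex_assign_set)
      also have "\<dots> = \<phi> ` assign_set"
        by (simp add: image_image \<phi>_def)
      finally show ?thesis .
    qed
    moreover have "(a \<bullet> (X *v w) - b, c \<bullet> (X *v w)) \<in> \<phi> ` assign_set"
      using X by (auto simp: \<phi>_def)
    moreover have "v < ?d" if "(u, v) \<in> \<phi> ` assign_set" "u \<le> 0" for u v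
      using that * by (auto simp: \<phi>_def dest!: max)
    ultimately obtain l where "0 \<le> l" and l: "\<forall>(u, v)\<in>\<phi> ` assign_set. v - l * u < ?d"
      using multiplier_below_exists X(2) by (metis diff_le_0_iff_le)
    obtain Z where "Z \<in> assign_set"
      "dual_fun c a w b l = c \<bullet> (Z *v w) - l * (a \<bullet> (Z *v w) - b)"
      using dual_fun_attained[OF card] by metis
    \<comment> \<open>The strict bound survives the supremum because it is attained at
      \<open>Z\<close>.\<close>
    then have "dual_fun c a w b l < ?d"
      using l by (auto simp: \<phi>_def)
    with min[OF \<open>0 \<le> l\<close>] show False by simp
  qed
  moreover have "c \<bullet> (Y *v w) - lopt * (a \<bullet> (Y *v w) - b) \<le> ?d"
    using dual_fun_attained[OF card] Y by metis
  moreover have "lopt * (a \<bullet> (X *v w) - b) \<le> 0"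
    using l0 X(2) by (simp add: mult_nonneg_nonpos)
  ultimately show ?thesis
    by (simp add: inner_diff_left algebra_simps)
qed

text \<open>The column sums give \<open>X\<close> total mass \<open>CARD('n)\<close>. If all the
  rows \<open>\<iota> k\<close> were full, they would use up this mass and leave nothing for row
  \<open>i\<close>.\<close>

lemma row_with_spare_capacity:
  fixes X :: "real^'n::finite^'m::finite"
  assumes X: "X \<in> assign_set" and inj: "inj \<iota>" and i: "i \<notin> range (\<iota> :: 'n \<Rightarrow> 'm)"
    and pos: "0 < X $ i $ j"
  shows "\<exists>k. (\<Sum>s\<in>UNIV. X $ \<iota> k $ s) < 1"
proof (rule ccontr)
  let ?r = "\<lambda>p. \<Sum>s\<in>UNIV. X $ p $ s"
  have nn: "0 \<le> X $ p $ s" for p s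
    using X by (simp add: assign_set_iff)
  assume "\<not> ?thesis"
  then have "real CARD('n) \<le> (\<Sum>k\<in>UNIV. ?r (\<iota> k))"
    using sum_mono[of UNIV "\<lambda>_. 1" "\<lambda>k. ?r (\<iota> k)"] by (simp add: not_less)
  also have "\<dots> = sum ?r (range \<iota>)"
    using inj by (simp add: sum.reindex)
  also have "\<dots> + X $ i $ j \<le> sum ?r (range \<iota>) + ?r i"
    by (intro add_left_mono member_le_sum) (auto simp: nn)
  also have "\<dots> = sum ?r (insert i (range \<iota>))"
    using i by simp
  also have "\<dots> \<le> sum ?r UNIV"
    by (intro sum_mono2) (auto intro: sum_nonneg nn)
  also have "\<dots> = (\<Sum>s\<in>UNIV. \<Sum>p\<in>UNIV. X $ p $ s)"
    by (rule sum.swap)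
  also have "\<dots> = real CARD('n)"
    using X by (simp add: assign_set_iff)
  finally show False using pos by simp
qed

lemma dominated_row_zero:
  fixes X :: "real^'n::finite^'m::finite" and z :: "real^'m"
  assumes X: "X \<in> assign_set"
    and max: "\<And>Y. Y \<in> assign_set \<Longrightarrow> z \<bullet> (Y *v w) \<le> z \<bullet> (X *v w)"
    and w: "\<And>j. 0 < w $ j"
    and inj: "inj \<iota>" and z: "\<And>k :: 'n. z $ i < z $ \<iota> k"
  shows "row i X = 0"
proof (rule ccontr)
  assume "row i X \<noteq> 0"
  have nn: "0 \<le> X $ p $ s" for p s
    using X by (simp add: assign_set_iff)
  from \<open>row i X \<noteq> 0\<close> obtain j where pos: "0 < X $ i $ j"
    using nn by (force simp: row_def vec_eq_iff less_le)
  have "i \<notin> range \<iota>" using z by force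
  then obtain k where k: "(\<Sum>s\<in>UNIV. X $ \<iota> k $ s) < 1"
    using row_with_spare_capacity[OF X inj _ pos] by blast
  have neq: "\<iota> k \<noteq> i" using z[of k] by auto
  \<comment> \<open>The largest amount that can leave entry \<open>(i, j)\<close> and still fit into
    row \<open>\<iota> k\<close>.\<close>
  define e where "e = min (X $ i $ j) (1 - (\<Sum>s\<in>UNIV. X $ \<iota> k $ s))"
  have e: "0 < e" "e \<le> X $ i $ j" "(\<Sum>s\<in>UNIV. X $ \<iota> k $ s) + e \<le> 1"
    using pos k by (auto simp: e_def)
  \<comment> \<open>The change made to column \<open>j\<close>: its coordinates sum to zero, so
    column sums are preserved, and the objective gains
    \<open>w $ j * (z \<bullet> D)\<close>.\<close>
  define D :: "real^'m" where "D = axis (\<iota> k) e - axis i e"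
  define Y :: "real^'n^'m" where "Y = (\<chi> p s. X $ p $ s + (if s = j then D $ p else 0))"
  have D: "D $ p = (if p = \<iota> k then e else 0) - (if p = i then e else 0)" for p
    by (auto simp: D_def axis_def)
  have "Y \<in> assign_set"
    unfolding assign_set_iff
  proof (intro conjI allI)
    fix p s
    have "(\<Sum>s\<in>UNIV. Y $ p $ s) = (\<Sum>s\<in>UNIV. X $ p $ s) + D $ p"
      by (simp add: Y_def sum.distrib)
    also have "\<dots> \<le> 1"
    proof (cases "p = \<iota> k")
      case True
      then show ?thesis using e neq by (simp add: D)
    next
      case False
      have "(\<Sum>s\<in>UNIV. X $ p $ s) \<le> 1" using X by (simp add: assign_set_iff)
      then show ?thesis using e False by (auto simp: D)
    qed
    finally show "(\<Sum>s\<in>UNIV. Y $ p $ s) \<le> 1" .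
    have "(\<Sum>p\<in>UNIV. D $ p) = 0" by (simp add: D sum_subtractf)
    then show "(\<Sum>p\<in>UNIV. Y $ p $ s) = 1"
      using X by (cases "s = j") (simp_all add: Y_def sum.distrib assign_set_iff)
    show "0 \<le> Y $ p $ s"
      using nn[of p s] e by (auto simp: Y_def D)
  qed
  moreover have "Y *v w = X *v w + w $ j *\<^sub>R D"
    by (simp add: vec_eq_iff matrix_vector_mult_def Y_def distrib_right sum.distrib
        if_distribR if_distrib[of "\<lambda>x. x * _"] cong: if_cong)
  moreover have "z \<bullet> D = e * (z $ \<iota> k - z $ i)"
    by (simp add: D_def inner_diff_right inner_axis algebra_simps)
  ultimately have "w $ j * (e * (z $ \<iota> k - z $ i)) \<le> 0"
    using max[of Y] by (simp add: inner_add_right)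
  moreover have "0 < w $ j * (e * (z $ \<iota> k - z $ i))"
    using w z e by simp
  ultimately show False by simp
qed

text \<open>The gap between the two sides is affine in \<open>l\<close>, hence at least its value at
  one end point: \<open>l2\<close> if \<open>x \<le> y\<close>, \<open>l1\<close> otherwise.\<close>

lemma affine_less_between:
  fixes x y :: real
  assumes "p - l1 * x < q - l1 * y" "p - l2 * x < q - l2 * y" "l1 \<le> l" "l \<le> l2"
  shows "p - l * x < q - l * y"
proof (cases "x \<le> y")
  case True
  then have "l * (y - x) \<le> l2 * (y - x)"
    using assms by (intro mult_right_mono) auto
  then show ?thesis using assms by (simp add: algebra_simps)
next
  case False
  then have "l1 * (x - y) \<le> l * (x - y)"
    using assms by (intro mult_right_mono) auto
  then show ?thesis using assms by (simp add: algebra_simps)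
qed

theorem lemma3:
  fixes c a :: "real^'m::finite" and w :: "real^'n::{finite,linorder}"
    and b2 lopt lmin lmax :: real and i :: 'm
  assumes "CARD('n) \<le> CARD('m)"
    and "\<And>j k. j < k \<Longrightarrow> w $ k < w $ j"
    and "\<And>j. 0 < w $ j"
    and "is_arg_min (dual_fun c a w b2) (\<lambda>l. 0 \<le> l) lopt"
    and "lmin \<le> lopt" and "lopt \<le> lmax"
    and "\<exists>\<iota> :: 'n \<Rightarrow> 'm. inj \<iota> \<and>
           (c - lmin *\<^sub>R a) $ i < (MIN k. (c - lmin *\<^sub>R a) $ \<iota> k) \<and>
           (c - lmax *\<^sub>R a) $ i < (MIN k. (c - lmax *\<^sub>R a) $ \<iota> k)"
  shows "\<forall>X.
           is_arg_max (\<lambda>X. c \<bullet> (X *v w)) (\<lambda>X. X \<in> assign_set \<and> a \<bullet> (X *v w) \<le> b2) X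
             \<longrightarrow> row i X = 0"
proof (intro allI impI)
  fix X
  assume X: "is_arg_max (\<lambda>X. c \<bullet> (X *v w)) (\<lambda>X. X \<in> assign_set \<and> a \<bullet> (X *v w) \<le> b2) X"
  obtain \<iota> :: "'n \<Rightarrow> 'm" where "inj \<iota>"
    and "\<And>k. (c - lmin *\<^sub>R a) $ i < (c - lmin *\<^sub>R a) $ \<iota> k"
    and "\<And>k. (c - lmax *\<^sub>R a) $ i < (c - lmax *\<^sub>R a) $ \<iota> k"
    using assms(7) by auto
  then have "(c - lopt *\<^sub>R a) $ i < (c - lopt *\<^sub>R a) $ \<iota> k" for k
    using affine_less_between[OF _ _ assms(5,6)] by simp
  moreover have "X \<in> assign_set"
    using X by (simp add: is_arg_max_def)
  ultimately show "row i X = 0"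
    using primal_optimal_maximizes_lagrangian[OF assms(1,4) X] assms(3) \<open>inj \<iota>\<close>
    by (intro dominated_row_zero) auto
qed

end
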